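(* Let the risk frontier $\mathcal U$ have the recursive structure described in the context, and suppose the GCR-MDP $\min_{\pi\in\Pi}\varrho_{\mathcal U}(R^\pi_{0:T})$ has an information state generator $\mathcal I=\{(\mathbb Y_t,\sigma_t)\}_{t\in[T+1]}$. Let $\bar\pi^*=(\bar\pi^*_t)_{t=0}^T$ be the greedy policy with respect to $\{\bar V_t\}$, where for each $t\in[T]$ and all $h_t\in\mathbb H_t$, $\bar\pi_t^*=(\bar\pi_t^{a*},\bar\pi_t^{z*})$ is defined by $$\bar\pi_t^{a*}(\sigma_t(h_t))=a_t^*,\qquad R_t(s_t,a_t^* )=X_t^*,\ a_t^*\in\mathbb A,\qquad \bar\pi_t^{z*}(\sigma_t(h_t))=z_t^*,$$ $$(X_t^*,z_t^*,\varphi_t^* )\in\arg\min_{(X_t,z_t,\varphi_t)}\{\varphi_t:(X_t,z_t,\varphi_t)\in\bar{\mathcal Q}_t(\sigma_t(h_t),\bar V_{t+1})\}.$$ Then: (i) $\bar\pi^*$ is optimal for $\min_{\bar\pi\in\bar\Pi}\varrho_{\bar{\mathcal U}}(R_{0:T}^{\bar\pi})$. (ii) $\bar\pi^*$ is time-consistent, i.e. $\bar\pi^*_{t:T}=(\bar\pi^*_t,\dots,\bar\pi^*_T)$ is optimal for $\bar V_t(y_t)=\min_{\bar\pi_{t:T}}\bar V_t^{\bar\pi_{t:T}}(y_t)$ for all $y_t\in\mathbb Y_t$ and $t\in[T]$.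
   Context: Notation: $[n]=\{0,\dots,n\}$, $[n_1,n_2]=\{n_1,\dots,n_2\}$. Fix a horizon $0\le T<\infty$. MDP: the state space $\mathbb S$, action space $\mathbb A$ and data space $\Xi$ are finite, $s_0\in\mathbb S$ is fixed, $s_{t+1}=f_t(s_t,a_t,\xi_t)$ with $f_t:\mathbb S\times\mathbb A\times\Xi\to\mathbb S$ for $t\in[T-1]$; $\{\xi_t\}$ are independent with $\xi_t\sim P_t$, a probability measure on $\Xi$. Payoffs are $r_t:\mathbb S\times\mathbb A\times\Xi\to\mathbb R$, $|r_t|\le R_{\max}<\infty$, $t\in[T]$; $R_t(s,a)$ is the random payoff with $[R_t(s,a)](\xi_t)=r_t(s,a,\xi_t)$. Histories are $h_t=(s_0,a_0,\xi_0,\dots,a_{t-1},\xi_{t-1})$, $t\in[T+1]$; $\mathbb H_t$ is the set of them; $h_t$ implicitly determines past payoffs, disbursements and premiums (perfect recall). $\mathcal L_t$ is the space of bounded random variables determined by $h_t$; $\mathcal L_{t:T}=\prod_{k=t}^T\mathcal L_k$, $\mathcal L_{t+1:T+1}=\prod_{k=t+1}^{T+1}\mathcal L_k$. Payoffs satisfy $X_k\in\mathcal L_{k+1}$, disbursements and premiums $Z_k,\Phi_k\in\mathcal L_k$; $\varphi_0$ is the constant $\Phi_0$. Inequalities are componentwise and almost sure. $[\,\cdot\mid h_t]$, $[\,\cdot\mid y_t]$ denote conditioning. Policies: $\Pi$ is the set of $\pi=(\pi_t)_{t\in[T]}$, $\pi_t=(\pi_t^a,\pi_t^z):\mathbb H_t\to\mathbb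 A\times\mathbb R$; $R_t^\pi(h_t,\xi_t)=r_t(s_t,\pi_t^a(h_t),\xi_t)$, $Z_t^\pi(h_t)=\pi_t^z(h_t)$. Risk frontier: a set $\mathcal U\subset\mathcal L_{1:T+1}\times\mathcal L_{0:T}\times\mathcal L_{0:T}$ is a risk frontier if: (i) membership of $(X_{0:T},Z_{0:T},\Phi_{0:T})$ implies that of $(X'_{0:T},Z_{0:T},\Phi_{0:T})$ for all $X'_{0:T}\ge X_{0:T}$; (ii) membership of $(X_{0:T},Z_{0:T},\Phi_{0:T})$ implies that of $(X_{0:T},Z_{0:T},\Phi_{0:T}+\Phi'_{0:T})$ for all $\Phi'_{0:T}\ge0$ with $\Phi'_t(h_t)\ge\mathbb E[\Phi'_{t+1}\mid h_t]$ for all $h_t$, $t\in[T-1]$; (iii) membership of $(X_{0:T},Z_{0:T},\Phi_{0:T})$ and $Z'_{0:T}\ge Z_{0:T}$ imply membership of $(X_{0:T},Z'_{0:T},\Phi'_{0:T})$ for some $\Phi'_{0:T}\ge\Phi_{0:T}$; (iv) $\mathcal U$ is closed. The generalized capital requirement (GCR) is $\varrho_{\mathcal U}(X_{0:T})=\min_{Z_{0:T},\Phi_{0:T}}\{\varphi_0:(X_{0:T},Z_{0:T},\Phi_{0:T})\in\mathcal U\}$, and the GCR-MDP, in which the disbursements are chosen by the policy, is $\min_{\pi\in\Pi}\varrho_{\mathcal U}(R_{0:T}^\pi)\equiv\min_{\pi\in\Pi,\Phi_{0:T}}\{\varphi_0:(R_{0:T}^\pi,Z_{0:T}^\pi,\Phi_{0:T})\in\mathcal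 U\}$. Recursive structure: a terminal input $\Phi_{T+1}\in\mathcal L_{T+1}$ is fixed and there are correspondences $\mathcal U_t:\mathbb H_t\times\mathcal L_{t+1}\rightrightarrows\mathcal L_{t+1}\times\mathbb R\times\mathbb R$, $t\in[T]$, such that (a) $\mathcal U=\{(X_{0:T},Z_{0:T},\Phi_{0:T}):[(X_t,Z_t,\Phi_t)\mid h_t]\in\mathcal U_t(h_t,\Phi_{t+1}),\ \forall h_t\in\mathbb H_t,\ \forall t\in[T]\}$; (b) $(X_t,z_t,\varphi_t)\in\mathcal U_t(h_t,\Phi_{t+1})$ and $X_t\le X'_t$ imply $(X'_t,z_t,\varphi_t)\in\mathcal U_t(h_t,\Phi_{t+1})$; (c) $\Phi_{t+1}\le\Phi'_{t+1}$ implies $\mathcal U_t(h_t,\Phi'_{t+1})\subset\mathcal U_t(h_t,\Phi_{t+1})$ for all $h_t$. Information state: $\mathbb Y_t$ ($t\in[T+1]$) are Banach spaces, $\sigma_t:\mathbb H_t\to\mathbb Y_t$ are history compression functions, $s_t$ is a component of $y_t=\sigma_t(h_t)$, $Y_t=\sigma_t(h_t)$ with corresponding $\sigma$-field $\mathcal G_t$, and $\bar{\mathcal L}_t\subset\mathcal L_t$ consists of the random variables that are functions of $\sigma_t(h_t)$. $\mathcal I$ is an information state generator for the GCR-MDP if: (1) $\Pr(Y_{t+1}\in B\mid h_t,a_t,z_t)=\Pr(Y_{t+1}\in B\mid\sigma_t(h_t),a_t,z_t)$ for all $B\in\mathcal G_{t+1}$, $a_t\in\mathbb A$, $z_t\in\mathbb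 R$, $h_t\in\mathbb H_t$, $t\in[T]$; (2) $\bar\Phi_{T+1}=\Phi_{T+1}\in\bar{\mathcal L}_{T+1}$; (3) for $t\in[T]$, $\mathcal U_t(h_t,\bar\Phi_{t+1})=\mathcal U_t(h'_t,\bar\Phi_{t+1})$ for all $\bar\Phi_{t+1}\in\bar{\mathcal L}_{t+1}$ and all $h_t,h'_t\in\mathbb H_t$ with $\sigma_t(h_t)=\sigma_t(h'_t)$. The information state evolves by $y_{t+1}=g_t(y_t,a_t,z_t,\xi_t)$ with $g_t:\mathbb Y_t\times\mathbb A\times\mathbb R\times\Xi\to\mathbb Y_{t+1}$, $t\in[T]$. Elements $y_t\in\mathbb Y_t$ are understood to be values attained by $\sigma_t$. Conditioning convention: conditionally on $h_t$ (or $y_t$), the period-$t$ action $a$ and disbursement $z_t$, elements of $\mathcal L_{t+1}$ are regarded as random variables of $\xi_t$, namely $\xi_t\mapsto X_t(y_t,a,\xi_t)$ and $\xi_t\mapsto\bar\Phi_{t+1}(g_t(y_t,a,z_t,\xi_t))$, and membership in $\mathcal U_t$, $\bar{\mathcal U}_t$ is understood for these; $a$ is the policy's action, or the action $a$ in $\bar{\mathcal D}_t$ below. Compressed risk frontiers: $\bar{\mathcal U}_t(y_t,\bar\Phi_{t+1})=\mathcal U_t(h_t,\bar\Phi_{t+1})$ for any $h_t$ with $\sigma_t(h_t)=y_t$. $\bar{\mathcal U}$ is the subset of triples in $\mathcal U$ that are Markov with respect to the information state: $\bar{\mathcal U}=\{(X_{0:T},\bar Z_{0:T},\bar\Phi_{0:T}):[(X_t,\bar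 Z_t,\bar\Phi_t)\mid y_t]\in\bar{\mathcal U}_t(y_t,\bar\Phi_{t+1}),\ \forall y_t\in\mathbb Y_t,\ \forall t\in[T]\}$ with $\bar Z_t,\bar\Phi_t\in\bar{\mathcal L}_t$. $\bar\Pi\subset\Pi$ is the class of policies $\bar\pi=(\bar\pi_t)_{t\in[T]}$, $\bar\pi_t=(\bar\pi_t^a,\bar\pi_t^z):\mathbb Y_t\to\mathbb A\times\mathbb R$, depending only on the information state; $\bar\pi_{t:T}=(\bar\pi_t,\dots,\bar\pi_T)$. The GCR-MDP on the information state is $\min_{\bar\pi\in\bar\Pi}\varrho_{\bar{\mathcal U}}(R_{0:T}^{\bar\pi})\equiv\min_{\bar\pi\in\bar\Pi,\bar\Phi_{0:T}}\{\varphi_0:(R_{0:T}^{\bar\pi},Z_{0:T}^{\bar\pi},\bar\Phi_{0:T})\in\bar{\mathcal U}\}$; a policy is optimal if it is the $\bar\pi$-component of a minimizer. Value functions: $\bar V_{T+1}=\bar\Phi_{T+1}$ is the given terminal input; for $t\in[T]$, $$\bar V_t^{\bar\pi_{t:T}}(y_t)=\min_{\bar\Phi_{t:T}}\{\bar\Phi_t(y_t):[(R_k^{\bar\pi},Z_k^{\bar\pi},\bar\Phi_k)\mid y_k]\in\bar{\mathcal U}_k(y_k,\bar\Phi_{k+1}),\ \forall y_k\in\mathbb Y_k,\ \forall k\in[t,T]\}$$ (infeasible problems have value $+\infty$) and $\bar V_t(y_t)=\min_{\bar\pi_{t:T}}\bar V_t^{\bar\pi_{t:T}}(y_t)$; the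 latter minima are understood to exist so that $\bar V_t$ is a bounded real function. Dominance constraints: $\bar{\mathcal D}_t(y_t,\bar V_{t+1})$ is the set of $(X_t,z_t,\bar\Phi_{t+1})\in\bar{\mathcal L}_{t+1}\times\mathbb R\times\bar{\mathcal L}_{t+1}$ for which there is $a\in\mathbb A$ with $X_t(y_t,a,\xi_t)\le r_t(s_t,a,\xi_t)$ and $\bar V_{t+1}(g_t(y_t,a,z_t,\xi_t))\le\bar\Phi_{t+1}(g_t(y_t,a,z_t,\xi_t))$ for all $\xi_t\in\Xi$. $\bar{\mathcal Q}_t(y_t,\bar V_{t+1})$ is the set of $(X_t,z_t,\varphi_t)\in\bar{\mathcal L}_{t+1}\times\mathbb R\times\mathbb R$ such that, for some $\bar\Phi_{t+1}\in\bar{\mathcal L}_{t+1}$, $(X_t,z_t,\varphi_t)\in\bar{\mathcal U}_t(y_t,\bar\Phi_{t+1})$ and $(X_t,z_t,\bar\Phi_{t+1})\in\bar{\mathcal D}_t(y_t,\bar V_{t+1})$.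
   Formalization: The greedy action a_t^* is required not only to satisfy R_t(s_t,a_t^* )=X_t^* but also to be the action witnessing that (X_t^*,z_t^*,φ_t^* ) lies in Q̄_t; otherwise an action with equal payoff but worse transitions could be chosen and the claim fails. *)

theory Defs
  imports "HOL-Probability.Probability"
begin

record ('s, 'a, 'x) mdp =
  horizon :: nat
  init_state :: 's
  trans :: "nat \<Rightarrow> 's \<Rightarrow> 'a \<Rightarrow> 'x \<Rightarrow> 's"
  law :: "nat \<Rightarrow> 'x pmf"
  payoff :: "nat \<Rightarrow> 's \<Rightarrow> 'a \<Rightarrow> 'x \<Rightarrow> real"

text \<open>
  The fixed initial state is left out of a history, which is thus the list of its (action, datum)
  pairs.  Independence of the data is encoded by always drawing the period-\<open>t\<close> datum from
  \<open>law M t\<close>, whatever the history.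

  A history implicitly determines the past disbursements.  A recall history spells them out
  as a list of (action, disbursement, datum) triples; \<open>recall Z h\<close> is the recall history
  belonging to \<open>h\<close> under the disbursement process \<open>Z\<close>.  An information state whose
  evolution \<open>y\<^sub>t\<^sub>+\<^sub>1 = g\<^sub>t(y\<^sub>t, a\<^sub>t, z\<^sub>t, \<xi>\<^sub>t)\<close> genuinely depends on \<open>z\<^sub>t\<close> can only be a
  function of recall histories.
\<close>

type_synonym ('a, 'x) history = "('a \<times> 'x) list"
type_synonym ('a, 'x) rhistory = "('a \<times> real \<times> 'x) list"

definition histories :: "nat \<Rightarrow> 'e list set" where
  "histories t = {h. length h = t}"

definition recall ::
    "(nat \<Rightarrow> ('a, 'x) history \<Rightarrow> real) \<Rightarrow> ('a, 'x) history \<Rightarrow> ('a, 'x) rhistory" where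
  "recall Z h = map (\<lambda>i. (fst (h ! i), Z i (take i h), snd (h ! i))) [0..<length h]"

definition state_of :: "('s, 'a, 'x) mdp \<Rightarrow> ('a, 'x) rhistory \<Rightarrow> 's" where
  "state_of M h =
     fold (\<lambda>i s. trans M i s (fst (h ! i)) (snd (snd (h ! i)))) [0..<length h] (init_state M)"

text \<open>
  A member of \<open>\<L>\<^sub>k\<close> is a real function on the histories of length \<open>k\<close>; there are finitely many of
  those, so it is bounded, and the product topology used for closedness below is the usual one.
  In a triple \<open>(X, Z, \<Phi>)\<close>, \<open>X t\<close> is evaluated at histories of length \<open>t + 1\<close>,
  and \<open>Z t\<close> and \<open>\<Phi> t\<close> at histories of length \<open>t\<close>; other arguments are irrelevant.
\<close>

type_synonym ('a, 'x) process = "nat \<Rightarrow> ('a, 'x) history \<Rightarrow> real"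
type_synonym ('a, 'x) act_rule = "nat \<Rightarrow> ('a, 'x) history \<Rightarrow> 'a"
type_synonym ('a, 'x) triple_set =
  "(('a, 'x) process \<times> ('a, 'x) process \<times> ('a, 'x) process) set"

definition le_as ::
    "('s, 'a, 'x) mdp \<Rightarrow> nat \<Rightarrow> (('a, 'x) history \<Rightarrow> real) \<Rightarrow> (('a, 'x) history \<Rightarrow> real) \<Rightarrow> bool" where
  "le_as M k X X' \<longleftrightarrow>
     (\<forall>h\<in>histories k. (\<forall>i<k. snd (h ! i) \<in> set_pmf (law M i)) \<longrightarrow> X h \<le> X' h)"

text \<open>
  Conditioning on \<open>h\<^sub>t\<close> involves the action taken at \<open>h\<^sub>t\<close>, so a set of triples is considered
  relative to the rule \<open>\<alpha>\<close> by which the actions are chosen.  The inequalities in the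
  premises are required everywhere and the one in the conclusion almost surely, which makes
  the notion implied by the one with almost sure inequalities throughout.
\<close>

definition risk_frontier ::
    "('s, 'a, 'x) mdp \<Rightarrow> ('a, 'x) act_rule \<Rightarrow> ('a, 'x) triple_set \<Rightarrow> bool" where
  "risk_frontier M \<alpha> W \<longleftrightarrow>
     (\<forall>X Z \<Phi> X'. (X, Z, \<Phi>) \<in> W \<and>
        (\<forall>t\<le>horizon M. \<forall>h\<in>histories (Suc t). X t h \<le> X' t h) \<longrightarrow> (X', Z, \<Phi>) \<in> W) \<and>
     (\<forall>X Z \<Phi> \<Phi>'. (X, Z, \<Phi>) \<in> W \<and>
        (\<forall>t\<le>horizon M. \<forall>h\<in>histories t. 0 \<le> \<Phi>' t h) \<and>
        (\<forall>t<horizon M. \<forall>h\<in>histories t.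
           measure_pmf.expectation (law M t) (\<lambda>\<xi>. \<Phi>' (Suc t) (h @ [(\<alpha> t h, \<xi>)])) \<le> \<Phi>' t h)
        \<longrightarrow> (X, Z, \<lambda>t h. \<Phi> t h + \<Phi>' t h) \<in> W) \<and>
     (\<forall>X Z \<Phi> Z'. (X, Z, \<Phi>) \<in> W \<and>
        (\<forall>t\<le>horizon M. \<forall>h\<in>histories t. Z t h \<le> Z' t h)
        \<longrightarrow> (\<exists>\<Phi>'. (\<forall>t\<le>horizon M. le_as M t (\<Phi> t) (\<Phi>' t)) \<and> (X, Z', \<Phi>') \<in> W)) \<and>
     closed W"

text \<open>
  The one-step correspondences act on period-\<open>t\<close> random variables in conditional form,
  i.e. on functions of the datum \<open>\<xi>\<^sub>t\<close>.
\<close>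

type_synonym ('a, 'x) step_sets =
  "nat \<Rightarrow> ('a, 'x) rhistory \<Rightarrow> ('x \<Rightarrow> real) \<Rightarrow> (('x \<Rightarrow> real) \<times> real \<times> real) set"

definition generated_frontier ::
    "('s, 'a, 'x) mdp \<Rightarrow> ('a, 'x) step_sets \<Rightarrow> (('a, 'x) rhistory \<Rightarrow> real)
     \<Rightarrow> ('a, 'x) act_rule \<Rightarrow> ('a, 'x) triple_set" where
  "generated_frontier M \<U> \<Phi>\<^sub>e \<alpha> =
     {(X, Z, \<Phi>). \<forall>t\<le>horizon M. \<forall>h\<in>histories t.
        (let h' = (\<lambda>\<xi>. h @ [(\<alpha> t h, \<xi>)]) in
          (\<lambda>\<xi>. X t (h' \<xi>), Z t h, \<Phi> t h)
            \<in> \<U> t (recall Z h)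
                 (\<lambda>\<xi>. if t < horizon M then \<Phi> (Suc t) (h' \<xi>) else \<Phi>\<^sub>e (recall Z (h' \<xi>))))}"

definition recursive_structure ::
    "('s, 'a, 'x) mdp \<Rightarrow> ('a, 'x) step_sets \<Rightarrow> (('a, 'x) rhistory \<Rightarrow> real)
     \<Rightarrow> (('a, 'x) act_rule \<Rightarrow> ('a, 'x) triple_set) \<Rightarrow> bool" where
  "recursive_structure M \<U> \<Phi>\<^sub>e W \<longleftrightarrow>
     (\<forall>\<alpha>. W \<alpha> = generated_frontier M \<U> \<Phi>\<^sub>e \<alpha>) \<and>
     (\<forall>t\<le>horizon M. \<forall>h\<in>histories t. \<forall>\<Phi> X X' z \<phi>.
        (X, z, \<phi>) \<in> \<U> t h \<Phi> \<and> X \<le> X' \<longrightarrow> (X', z, \<phi>) \<in> \<U> t h \<Phi>) \<and>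
     (\<forall>t\<le>horizon M. \<forall>h\<in>histories t. \<forall>\<Phi> \<Phi>'. \<Phi> \<le> \<Phi>' \<longrightarrow> \<U> t h \<Phi>' \<subseteq> \<U> t h \<Phi>)"

text \<open>
  The Banach spaces \<open>\<bbbY>\<^sub>0, \<dots>, \<bbbY>\<^sub>T\<^sub>+\<^sub>1\<close> are closed subspaces of one Banach space, for
  instance of their product.
\<close>

record ('s, 'a, 'x, 'y) info =
  info_space :: "nat \<Rightarrow> 'y set"
  compress :: "nat \<Rightarrow> ('a, 'x) rhistory \<Rightarrow> 'y"
  state_part :: "nat \<Rightarrow> 'y \<Rightarrow> 's"
  evolve :: "nat \<Rightarrow> 'y \<Rightarrow> 'a \<Rightarrow> real \<Rightarrow> 'x \<Rightarrow> 'y"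

definition attained :: "('s, 'a, 'x, 'y) info \<Rightarrow> nat \<Rightarrow> 'y set" where
  "attained I t = compress I t ` histories t"

definition info_structure ::
    "('s, 'a, 'x) mdp \<Rightarrow> ('s, 'a, 'x, 'y::banach) info \<Rightarrow> bool" where
  "info_structure M I \<longleftrightarrow>
     (\<forall>t\<le>Suc (horizon M). subspace (info_space I t) \<and> closed (info_space I t) \<and>
        compress I t ` histories t \<subseteq> info_space I t) \<and>
     (\<forall>t\<le>horizon M. \<forall>h\<in>histories t. state_part I t (compress I t h) = state_of M h) \<and>
     (\<forall>t\<le>horizon M. \<forall>y\<in>info_space I t. \<forall>a z \<xi>. evolve I t y a z \<xi> \<in> info_space I (Suc t)) \<and>
     (\<forall>t\<le>horizon M. \<forall>h\<in>histories t. \<forall>a z \<xi>.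
        compress I (Suc t) (h @ [(a, z, \<xi>)]) = evolve I t (compress I t h) a z \<xi>)"

text \<open>
  In the first clause \<open>\<kappa> t y a z\<close> is the conditional distribution of the next information
  state given the current one, the action and the disbursement.  Elements of \<open>\<L>\<^sub>t\<close>
  that are functions of the information state are represented by those functions.  As in the
  rest of the theory, the disbursement reached by \<open>\<Phi>\<close> in the third clause is that of
  the triple.
\<close>

definition info_state_generator ::
    "('s, 'a, 'x) mdp \<Rightarrow> ('a, 'x) step_sets \<Rightarrow> (('a, 'x) rhistory \<Rightarrow> real)
     \<Rightarrow> ('s, 'a, 'x, 'y::banach) info \<Rightarrow> ('y \<Rightarrow> real) \<Rightarrow> bool" where
  "info_state_generator M \<U> \<Phi>\<^sub>e I \<Phi>\<^sub>b \<longleftrightarrow>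
     (\<exists>\<kappa> :: nat \<Rightarrow> 'y \<Rightarrow> 'a \<Rightarrow> real \<Rightarrow> 'y set \<Rightarrow> real.
        \<forall>t\<le>horizon M. \<forall>h\<in>histories t. \<forall>a z. \<forall>B\<in>sets borel.
          measure_pmf.prob (law M t) {\<xi>. compress I (Suc t) (h @ [(a, z, \<xi>)]) \<in> B}
            = \<kappa> t (compress I t h) a z B) \<and>
     (\<forall>h\<in>histories (Suc (horizon M)). \<Phi>\<^sub>e h = \<Phi>\<^sub>b (compress I (Suc (horizon M)) h)) \<and>
     (\<forall>t\<le>horizon M. \<forall>h\<in>histories t. \<forall>h'\<in>histories t. compress I t h = compress I t h' \<longrightarrow>
        (\<forall>(\<Phi> :: 'y \<Rightarrow> real) a.
          {(X, z, \<phi>). (X, z, \<phi>) \<in> \<U> t h (\<lambda>\<xi>. \<Phi> (compress I (Suc t) (h @ [(a, z, \<xi>)])))}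
          = {(X, z, \<phi>). (X, z, \<phi>) \<in> \<U> t h' (\<lambda>\<xi>. \<Phi> (compress I (Suc t) (h' @ [(a, z, \<xi>)])))}))"

definition compressed ::
    "('a, 'x) step_sets \<Rightarrow> ('s, 'a, 'x, 'y) info \<Rightarrow> nat \<Rightarrow> 'y \<Rightarrow> 'a \<Rightarrow> ('y \<Rightarrow> real)
     \<Rightarrow> (('x \<Rightarrow> real) \<times> real \<times> real) set" where
  "compressed \<U> I t y a \<Phi> =
     {(X, z, \<phi>). (X, z, \<phi>) \<in> \<U> t (SOME h. h \<in> histories t \<and> compress I t h = y)
                              (\<lambda>\<xi>. \<Phi> (evolve I t y a z \<xi>))}"

text \<open>
  Markov triples: \<open>X t y\<close> is the payoff conditional on the information state \<open>y\<close> and the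
  action \<open>\<alpha> t y\<close>, as a function of the datum.  \<open>\<Phi>\<^sub>b\<close> is the terminal input.
\<close>

definition markov_frontier ::
    "('s, 'a, 'x) mdp \<Rightarrow> ('a, 'x) step_sets \<Rightarrow> ('s, 'a, 'x, 'y) info \<Rightarrow> ('y \<Rightarrow> real)
     \<Rightarrow> (nat \<Rightarrow> 'y \<Rightarrow> 'a)
     \<Rightarrow> ((nat \<Rightarrow> 'y \<Rightarrow> 'x \<Rightarrow> real) \<times> (nat \<Rightarrow> 'y \<Rightarrow> real) \<times> (nat \<Rightarrow> 'y \<Rightarrow> real)) set" where
  "markov_frontier M \<U> I \<Phi>\<^sub>b \<alpha> =
     {(X, Z, \<Phi>). \<forall>t\<le>horizon M. \<forall>y\<in>attained I t.
        (X t y, Z t y, \<Phi> t y)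
          \<in> compressed \<U> I t y (\<alpha> t y) ((\<Phi>(Suc (horizon M) := \<Phi>\<^sub>b)) (Suc t))}"

type_synonym ('a, 'y) policy = "nat \<Rightarrow> 'y \<Rightarrow> 'a \<times> real"

definition act :: "('a, 'y) policy \<Rightarrow> nat \<Rightarrow> 'y \<Rightarrow> 'a" where
  "act \<pi> t y = fst (\<pi> t y)"

definition disb :: "('a, 'y) policy \<Rightarrow> nat \<Rightarrow> 'y \<Rightarrow> real" where
  "disb \<pi> t y = snd (\<pi> t y)"

definition reward ::
    "('s, 'a, 'x) mdp \<Rightarrow> ('s, 'a, 'x, 'y) info \<Rightarrow> ('a, 'y) policy \<Rightarrow> nat \<Rightarrow> 'y \<Rightarrow> 'x \<Rightarrow> real" where
  "reward M I \<pi> t y \<xi> = payoff M t (state_part I t y) (act \<pi> t y) \<xi>"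

definition gcr_mdp_optimal ::
    "('s, 'a, 'x) mdp \<Rightarrow> ('a, 'x) step_sets \<Rightarrow> ('s, 'a, 'x, 'y) info \<Rightarrow> ('y \<Rightarrow> real)
     \<Rightarrow> ('a, 'y) policy \<Rightarrow> bool" where
  "gcr_mdp_optimal M \<U> I \<Phi>\<^sub>b \<pi> \<longleftrightarrow>
     (\<exists>\<Phi>. is_arg_min (\<lambda>(\<pi>', \<Phi>'). \<Phi>' 0 (compress I 0 []))
            (\<lambda>(\<pi>', \<Phi>'). (reward M I \<pi>', disb \<pi>', \<Phi>') \<in> markov_frontier M \<U> I \<Phi>\<^sub>b (act \<pi>'))
            (\<pi>, \<Phi>))"

definition tail_feasible ::
    "('s, 'a, 'x) mdp \<Rightarrow> ('a, 'x) step_sets \<Rightarrow> ('s, 'a, 'x, 'y) info \<Rightarrow> ('y \<Rightarrow> real)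
     \<Rightarrow> nat \<Rightarrow> ('a, 'y) policy \<Rightarrow> (nat \<Rightarrow> 'y \<Rightarrow> real) \<Rightarrow> bool" where
  "tail_feasible M \<U> I \<Phi>\<^sub>b t \<pi> \<Phi> \<longleftrightarrow>
     (\<forall>k\<in>{t..horizon M}. \<forall>y\<in>attained I k.
        (reward M I \<pi> k y, disb \<pi> k y, \<Phi> k y)
          \<in> compressed \<U> I k y (act \<pi> k y) ((\<Phi>(Suc (horizon M) := \<Phi>\<^sub>b)) (Suc k)))"

definition policy_val ::
    "('s, 'a, 'x) mdp \<Rightarrow> ('a, 'x) step_sets \<Rightarrow> ('s, 'a, 'x, 'y) info \<Rightarrow> ('y \<Rightarrow> real)
     \<Rightarrow> nat \<Rightarrow> ('a, 'y) policy \<Rightarrow> 'y \<Rightarrow> ereal" where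
  "policy_val M \<U> I \<Phi>\<^sub>b t \<pi> y = Inf {ereal (\<Phi> t y) |\<Phi>. tail_feasible M \<U> I \<Phi>\<^sub>b t \<pi> \<Phi>}"

definition opt_val ::
    "('s, 'a, 'x) mdp \<Rightarrow> ('a, 'x) step_sets \<Rightarrow> ('s, 'a, 'x, 'y) info \<Rightarrow> ('y \<Rightarrow> real)
     \<Rightarrow> nat \<Rightarrow> 'y \<Rightarrow> ereal" where
  "opt_val M \<U> I \<Phi>\<^sub>b t y =
     (if t \<le> horizon M then INF \<pi>. policy_val M \<U> I \<Phi>\<^sub>b t \<pi> y else ereal (\<Phi>\<^sub>b y))"

text \<open>
  The values are minima, not just infima: optimality of a policy comprises attainment of
  its own value by some \<open>\<Phi>\<close>.  Only the part of \<open>\<pi>\<close> from period \<open>t\<close> on matters.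
\<close>

definition tail_optimal ::
    "('s, 'a, 'x) mdp \<Rightarrow> ('a, 'x) step_sets \<Rightarrow> ('s, 'a, 'x, 'y) info \<Rightarrow> ('y \<Rightarrow> real)
     \<Rightarrow> nat \<Rightarrow> 'y \<Rightarrow> ('a, 'y) policy \<Rightarrow> bool" where
  "tail_optimal M \<U> I \<Phi>\<^sub>b t y \<pi> \<longleftrightarrow>
     policy_val M \<U> I \<Phi>\<^sub>b t \<pi> y = opt_val M \<U> I \<Phi>\<^sub>b t y \<and>
     (\<exists>\<Phi>. tail_feasible M \<U> I \<Phi>\<^sub>b t \<pi> \<Phi> \<and> ereal (\<Phi> t y) = policy_val M \<U> I \<Phi>\<^sub>b t \<pi> y)"

definition vals_exist ::
    "('s, 'a, 'x) mdp \<Rightarrow> ('a, 'x) step_sets \<Rightarrow> ('s, 'a, 'x, 'y) info \<Rightarrow> ('y \<Rightarrow> real) \<Rightarrow> bool" where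
  "vals_exist M \<U> I \<Phi>\<^sub>b \<longleftrightarrow>
     (\<forall>t\<le>horizon M.
        (\<forall>y\<in>attained I t. \<exists>\<pi>. tail_optimal M \<U> I \<Phi>\<^sub>b t y \<pi>) \<and>
        (\<exists>b :: real. \<forall>y\<in>attained I t. \<bar>opt_val M \<U> I \<Phi>\<^sub>b t y\<bar> \<le> ereal b))"

text \<open>
  Membership in \<open>\<Q>\<^sub>t\<close> is understood conditionally on the action \<open>a\<close> that witnesses the
  dominance constraint.  The one-step sets are therefore indexed by that action, and the
  set itself is the union over all actions.
\<close>

definition dominance_at ::
    "('s, 'a, 'x) mdp \<Rightarrow> ('s, 'a, 'x, 'y) info \<Rightarrow> nat \<Rightarrow> 'y \<Rightarrow> ('y \<Rightarrow> ereal) \<Rightarrow> 'a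
     \<Rightarrow> (('x \<Rightarrow> real) \<times> real \<times> ('y \<Rightarrow> real)) set" where
  "dominance_at M I t y V a =
     {(X, z, \<Phi>). \<forall>\<xi>. X \<xi> \<le> payoff M t (state_part I t y) a \<xi> \<and>
                       V (evolve I t y a z \<xi>) \<le> ereal (\<Phi> (evolve I t y a z \<xi>))}"

definition Q_at ::
    "('s, 'a, 'x) mdp \<Rightarrow> ('a, 'x) step_sets \<Rightarrow> ('s, 'a, 'x, 'y) info
     \<Rightarrow> nat \<Rightarrow> 'y \<Rightarrow> ('y \<Rightarrow> ereal) \<Rightarrow> 'a \<Rightarrow> (('x \<Rightarrow> real) \<times> real \<times> real) set" where
  "Q_at M \<U> I t y V a =
     {(X, z, \<phi>). \<exists>\<Phi>. (X, z, \<phi>) \<in> compressed \<U> I t y a \<Phi> \<and> (X, z, \<Phi>) \<in> dominance_at M I t y V a}"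

definition Q_set ::
    "('s, 'a, 'x) mdp \<Rightarrow> ('a, 'x) step_sets \<Rightarrow> ('s, 'a, 'x, 'y) info
     \<Rightarrow> nat \<Rightarrow> 'y \<Rightarrow> ('y \<Rightarrow> ereal) \<Rightarrow> (('x \<Rightarrow> real) \<times> real \<times> real) set" where
  "Q_set M \<U> I t y V = (\<Union>a. Q_at M \<U> I t y V a)"

text \<open>
  The greedy action has to witness membership of the chosen triple.  If it were only
  required to have payoff \<open>X\<close>, it could be exchanged for an action with the same payoff
  but worse transitions.
\<close>

definition greedy ::
    "('s, 'a, 'x) mdp \<Rightarrow> ('a, 'x) step_sets \<Rightarrow> ('s, 'a, 'x, 'y) info \<Rightarrow> ('y \<Rightarrow> real)
     \<Rightarrow> ('a, 'y) policy \<Rightarrow> bool" where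
  "greedy M \<U> I \<Phi>\<^sub>b \<pi> \<longleftrightarrow>
     (\<forall>t\<le>horizon M. \<forall>h\<in>histories t.
        (let y = compress I t h; a = act \<pi> t y; z = disb \<pi> t y; V = opt_val M \<U> I \<Phi>\<^sub>b (Suc t) in
          \<exists>X \<phi>. payoff M t (state_of M h) a = X \<and>
            (X, z, \<phi>) \<in> Q_at M \<U> I t y V a \<and>
            is_arg_min (\<lambda>(X, z, \<phi>). \<phi>) (\<lambda>w. w \<in> Q_set M \<U> I t y V) (X, z, \<phi>)))"

end

(*
  Write V for the optimal values.  Monotonicity of the one-step sets in the continuation lets the
  dominating continuation of a greedy triple be replaced by V itself, so by backward induction
  (greedy policy, V) is feasible from every period on as soon as the greedy minimum phi* at (t, y)
  equals V_t(y).  A tail-optimal policy at (t, y) provides a competitor with third component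
  V_t(y), since its capital process dominates V_{t+1}; hence phi* <= V_t(y).  Conversely, phi* at
  period t followed by V from t + 1 on is feasible for the greedy policy; hence V_t(y) <= phi*.
*)
theory Submission
  imports Defs
begin

text \<open>Since \<open>y\<close> is attained, the history picked by \<open>SOME\<close> really has
  length \<open>t\<close>, so monotonicity of the one-step sets applies to it. Those sets see the
  continuation only through the successors of \<open>y\<close> under \<open>a\<close> and
  \<open>z\<close>, hence a comparison there suffices.\<close>

lemma compressed_antimono:
  assumes "recursive_structure M \<U> \<Phi>\<^sub>e W" and "t \<le> horizon M" and "y \<in> attained I t"
    and "(X, z, \<phi>) \<in> compressed \<U> I t y a \<Phi>'"
    and "\<And>\<xi>. \<Phi> (evolve I t y a z \<xi>) \<le> \<Phi>' (evolve I t y a z \<xi>)"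
  shows "(X, z, \<phi>) \<in> compressed \<U> I t y a \<Phi>"
proof -
  define h where "h = (SOME h. h \<in> histories t \<and> compress I t h = y)"
  have "\<exists>h. h \<in> histories t \<and> compress I t h = y"
    using assms(3) by (auto simp: attained_def)
  then have h: "h \<in> histories t"
    unfolding h_def by (rule someI2_ex) simp
  have "(\<lambda>\<xi>. \<Phi> (evolve I t y a z \<xi>)) \<le> (\<lambda>\<xi>. \<Phi>' (evolve I t y a z \<xi>))"
    using assms(5) by (simp add: le_fun_def)
  then have "\<U> t h (\<lambda>\<xi>. \<Phi>' (evolve I t y a z \<xi>)) \<subseteq> \<U> t h (\<lambda>\<xi>. \<Phi> (evolve I t y a z \<xi>))"
    using assms(1,2) h unfolding recursive_structure_def by blast
  then show ?thesis
    using assms(4) by (auto simp: compressed_def h_def)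
qed

text \<open>Optimal values are known to be finite only at attained states; this carries that
  finiteness over to successor states.\<close>

lemma evolve_attained:
  assumes "info_structure M I" and "t \<le> horizon M" and "y \<in> attained I t"
  shows "evolve I t y a z \<xi> \<in> attained I (Suc t)"
proof -
  obtain h where h: "h \<in> histories t" "y = compress I t h"
    using assms(3) by (auto simp: attained_def)
  have "evolve I t y a z \<xi> = compress I (Suc t) (h @ [(a, z, \<xi>)])"
    using assms(1,2) h by (auto simp: info_structure_def)
  moreover have "h @ [(a, z, \<xi>)] \<in> histories (Suc t)"
    using h by (simp add: histories_def)
  ultimately show ?thesis
    by (simp add: attained_def)
qed

lemma opt_val_le_policy_val:
  "t \<le> horizon M \<Longrightarrow> opt_val M \<U> I \<Phi>\<^sub>b t y \<le> policy_val M \<U> I \<Phi>\<^sub>b t \<pi> y"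
  by (auto simp: opt_val_def intro: INF_lower)

lemma opt_val_le:
  assumes "tail_feasible M \<U> I \<Phi>\<^sub>b t \<pi> \<Phi>" and "t \<le> horizon M"
  shows "opt_val M \<U> I \<Phi>\<^sub>b t y \<le> ereal (\<Phi> t y)"
proof -
  have "opt_val M \<U> I \<Phi>\<^sub>b t y \<le> policy_val M \<U> I \<Phi>\<^sub>b t \<pi> y"
    using assms(2) by (rule opt_val_le_policy_val)
  also have "\<dots> \<le> ereal (\<Phi> t y)"
    unfolding policy_val_def using assms(1) by (intro Inf_lower) blast
  finally show ?thesis .
qed

lemma tail_feasible_Suc:
  "tail_feasible M \<U> I \<Phi>\<^sub>b t \<pi> \<Phi> \<Longrightarrow> tail_feasible M \<U> I \<Phi>\<^sub>b (Suc t) \<pi> \<Phi>"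
  by (simp add: tail_feasible_def)

text \<open>The period-\<open>k\<close> constraint involves \<open>\<Phi>\<close> only at
  \<open>k\<close> and \<open>Suc k\<close>, so the constraints after period \<open>t\<close> do not
  notice what is put at \<open>t\<close>.\<close>

lemma tail_feasible_step:
  assumes "t \<le> horizon M" and "tail_feasible M \<U> I \<Phi>\<^sub>b (Suc t) \<pi> \<Phi>"
    and "\<And>y. y \<in> attained I t \<Longrightarrow> (reward M I \<pi> t y, disb \<pi> t y, \<phi> y)
           \<in> compressed \<U> I t y (act \<pi> t y) ((\<Phi>(Suc (horizon M) := \<Phi>\<^sub>b)) (Suc t))"
  shows "tail_feasible M \<U> I \<Phi>\<^sub>b t \<pi> (\<Phi>(t := \<phi>))"
  unfolding tail_feasible_def
proof (intro ballI)
  fix k y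
  assume k: "k \<in> {t..horizon M}" and y: "y \<in> attained I k"
  have cont: "((\<Phi>(t := \<phi>))(Suc (horizon M) := \<Phi>\<^sub>b)) (Suc k)
      = (\<Phi>(Suc (horizon M) := \<Phi>\<^sub>b)) (Suc k)"
    using k by simp
  show "(reward M I \<pi> k y, disb \<pi> k y, (\<Phi>(t := \<phi>)) k y)
      \<in> compressed \<U> I k y (act \<pi> k y) (((\<Phi>(t := \<phi>))(Suc (horizon M) := \<Phi>\<^sub>b)) (Suc k))"
  proof (cases "k = t")
    case True
    then show ?thesis
      using assms(3) y unfolding cont by simp
  next
    case False
    with k have "k \<in> {Suc t..horizon M}"
      by simp
    then show ?thesis
      using assms(2) y False unfolding cont tail_feasible_def by simp
  qed
qed

lemma markov_frontier_iff_tail_feasible: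
  "(reward M I \<pi>, disb \<pi>, \<Phi>) \<in> markov_frontier M \<U> I \<Phi>\<^sub>b (act \<pi>)
     \<longleftrightarrow> tail_feasible M \<U> I \<Phi>\<^sub>b 0 \<pi> \<Phi>"
  by (auto simp: markov_frontier_def tail_feasible_def)

text \<open>Capital processes are real-valued, so the values are cast to reals. An infinite value
  would become 0, which makes this faithful only where finiteness is known.\<close>

definition val ::
    "('s, 'a, 'x) mdp \<Rightarrow> ('a, 'x) step_sets \<Rightarrow> ('s, 'a, 'x, 'y) info \<Rightarrow> ('y \<Rightarrow> real)
     \<Rightarrow> nat \<Rightarrow> 'y \<Rightarrow> real" where
  "val M \<U> I \<Phi>\<^sub>b t y = real_of_ereal (opt_val M \<U> I \<Phi>\<^sub>b t y)"

text \<open>Past the horizon \<open>opt_val\<close> is the terminal input by definition, so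
  overriding \<open>val\<close> there changes nothing.\<close>

lemma val_terminal [simp]: "(val M \<U> I \<Phi>\<^sub>b)(Suc (horizon M) := \<Phi>\<^sub>b) = val M \<U> I \<Phi>\<^sub>b"
  by (auto simp: fun_eq_iff val_def opt_val_def)

lemma opt_val_eq_val:
  assumes "vals_exist M \<U> I \<Phi>\<^sub>b" and "t \<le> Suc (horizon M)" and "y \<in> attained I t"
  shows "opt_val M \<U> I \<Phi>\<^sub>b t y = ereal (val M \<U> I \<Phi>\<^sub>b t y)"
proof (cases "t \<le> horizon M")
  case True
  then obtain b where "\<bar>opt_val M \<U> I \<Phi>\<^sub>b t y\<bar> \<le> ereal b"
    using assms(1,3) unfolding vals_exist_def by blast
  then have "\<bar>opt_val M \<U> I \<Phi>\<^sub>b t y\<bar> \<noteq> \<infinity>"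
    by auto
  then show ?thesis
    by (simp add: val_def ereal_real)
next
  case False
  then show ?thesis
    by (simp add: val_def opt_val_def)
qed

lemma val_le:
  assumes "vals_exist M \<U> I \<Phi>\<^sub>b" and "tail_feasible M \<U> I \<Phi>\<^sub>b t \<pi> \<Phi>"
    and "t \<le> horizon M" and "y \<in> attained I t"
  shows "val M \<U> I \<Phi>\<^sub>b t y \<le> \<Phi> t y"
  using opt_val_le[OF assms(2,3), of y] opt_val_eq_val[OF assms(1) _ assms(4)] assms(3) by simp

lemma val_attained:
  assumes "vals_exist M \<U> I \<Phi>\<^sub>b" and "t \<le> horizon M" and "y \<in> attained I t"
  obtains \<pi> \<Phi> where "tail_feasible M \<U> I \<Phi>\<^sub>b t \<pi> \<Phi>" and "\<Phi> t y = val M \<U> I \<Phi>\<^sub>b t y"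
proof -
  obtain \<pi> where "tail_optimal M \<U> I \<Phi>\<^sub>b t y \<pi>"
    using assms unfolding vals_exist_def by blast
  then obtain \<Phi> where "tail_feasible M \<U> I \<Phi>\<^sub>b t \<pi> \<Phi>"
    and "ereal (\<Phi> t y) = opt_val M \<U> I \<Phi>\<^sub>b t y"
    unfolding tail_optimal_def by auto
  with opt_val_eq_val[OF assms(1) _ assms(3)] assms(2) that show thesis
    by simp
qed

text \<open>This is the competitor for the greedy minimum. The tail-optimal policy behind it may
  vary with \<open>y\<close>, which is harmless because only its action and disbursement at
  \<open>y\<close> enter.\<close>

lemma val_in_Q_set:
  assumes "info_structure M I" and "vals_exist M \<U> I \<Phi>\<^sub>b"
    and "t \<le> horizon M" and "y \<in> attained I t"
  shows "\<exists>X z. (X, z, val M \<U> I \<Phi>\<^sub>b t y) \<in> Q_set M \<U> I t y (opt_val M \<U> I \<Phi>\<^sub>b (Suc t))"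
proof -
  obtain \<pi> \<Phi> where feas: "tail_feasible M \<U> I \<Phi>\<^sub>b t \<pi> \<Phi>" and eq: "\<Phi> t y = val M \<U> I \<Phi>\<^sub>b t y"
    using val_attained[OF assms(2-4)] .
  define \<Phi>' where "\<Phi>' = (\<Phi>(Suc (horizon M) := \<Phi>\<^sub>b)) (Suc t)"
  have mem: "(reward M I \<pi> t y, disb \<pi> t y, val M \<U> I \<Phi>\<^sub>b t y) \<in> compressed \<U> I t y (act \<pi> t y) \<Phi>'"
    using feas assms(3,4) unfolding tail_feasible_def \<Phi>'_def eq[symmetric] by simp
  \<comment> \<open>Before the last period, the tail of a feasible process is feasible for the next
    problem, whose value is an infimum. In the last period both sides are the terminal
    input.\<close>
  have "opt_val M \<U> I \<Phi>\<^sub>b (Suc t) y' \<le> ereal (\<Phi>' y')" for y'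
  proof (cases "Suc t \<le> horizon M")
    case True
    then show ?thesis
      using opt_val_le[OF tail_feasible_Suc[OF feas] True] by (simp add: \<Phi>'_def)
  next
    case False
    then show ?thesis
      using assms(3) by (simp add: \<Phi>'_def opt_val_def)
  qed
  then have "(reward M I \<pi> t y, disb \<pi> t y, \<Phi>')
      \<in> dominance_at M I t y (opt_val M \<U> I \<Phi>\<^sub>b (Suc t)) (act \<pi> t y)"
    by (simp add: dominance_at_def reward_def)
  with mem show ?thesis
    unfolding Q_set_def Q_at_def by blast
qed

text \<open>The dominance constraint and \<open>compressed_antimono\<close> speak about the same
  successors, so the witness can be lowered to the value function.\<close>

lemma Q_at_val:
  assumes "recursive_structure M \<U> \<Phi>\<^sub>e W" and "info_structure M I" and "vals_exist M \<U> I \<Phi>\<^sub>b"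
    and "t \<le> horizon M" and "y \<in> attained I t"
    and "(X, z, \<phi>) \<in> Q_at M \<U> I t y (opt_val M \<U> I \<Phi>\<^sub>b (Suc t)) a"
  shows "(X, z, \<phi>) \<in> compressed \<U> I t y a (val M \<U> I \<Phi>\<^sub>b (Suc t))"
proof -
  obtain \<Phi> where mem: "(X, z, \<phi>) \<in> compressed \<U> I t y a \<Phi>"
    and dom: "\<And>\<xi>. opt_val M \<U> I \<Phi>\<^sub>b (Suc t) (evolve I t y a z \<xi>) \<le> ereal (\<Phi> (evolve I t y a z \<xi>))"
    using assms(6) by (auto simp: Q_at_def dominance_at_def)
  have "val M \<U> I \<Phi>\<^sub>b (Suc t) (evolve I t y a z \<xi>) \<le> \<Phi> (evolve I t y a z \<xi>)" for \<xi>
    using dom[of \<xi>] opt_val_eq_val[OF assms(3) _ evolve_attained[OF assms(2,4,5)]] assms(4) by simp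
  then show ?thesis
    by (rule compressed_antimono[OF assms(1,4,5) mem])
qed

lemma greedyE:
  assumes "info_structure M I" and "greedy M \<U> I \<Phi>\<^sub>b \<pi>" and "t \<le> horizon M" and "y \<in> attained I t"
  obtains \<phi> where
    "(reward M I \<pi> t y, disb \<pi> t y, \<phi>) \<in> Q_at M \<U> I t y (opt_val M \<U> I \<Phi>\<^sub>b (Suc t)) (act \<pi> t y)"
    and "\<And>X z \<phi>'. (X, z, \<phi>') \<in> Q_set M \<U> I t y (opt_val M \<U> I \<Phi>\<^sub>b (Suc t)) \<Longrightarrow> \<phi> \<le> \<phi>'"
proof -
  obtain h where h: "h \<in> histories t" "y = compress I t h"
    using assms(4) by (auto simp: attained_def)
  have "state_part I t y = state_of M h"
    using assms(1,3) h by (simp add: info_structure_def)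
  then have "payoff M t (state_of M h) (act \<pi> t y) = reward M I \<pi> t y"
    by (simp add: reward_def fun_eq_iff)
  moreover obtain X \<phi> where "payoff M t (state_of M h) (act \<pi> t y) = X"
    and "(X, disb \<pi> t y, \<phi>) \<in> Q_at M \<U> I t y (opt_val M \<U> I \<Phi>\<^sub>b (Suc t)) (act \<pi> t y)"
    and "is_arg_min (\<lambda>(X, z, \<phi>). \<phi>) (\<lambda>w. w \<in> Q_set M \<U> I t y (opt_val M \<U> I \<Phi>\<^sub>b (Suc t)))
           (X, disb \<pi> t y, \<phi>)"
    using assms(2,3) h unfolding greedy_def Let_def by blast
  ultimately show thesis
    using that by (force simp: is_arg_min_linorder)
qed

lemma tail_feasible_greedy_val:
  assumes "recursive_structure M \<U> \<Phi>\<^sub>e W" and "info_structure M I" and "vals_exist M \<U> I \<Phi>\<^sub>b"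
    and "greedy M \<U> I \<Phi>\<^sub>b \<pi>" and "t \<le> Suc (horizon M)"
  shows "tail_feasible M \<U> I \<Phi>\<^sub>b t \<pi> (val M \<U> I \<Phi>\<^sub>b)"
  using assms(5)
\<comment> \<open>Backward induction, starting one period past the horizon, where no constraint is
  left.\<close>
proof (induction rule: inc_induct)
  case base
  then show ?case
    by (simp add: tail_feasible_def)
next
  case (step t)
  let ?V = "val M \<U> I \<Phi>\<^sub>b"
  have t: "t \<le> horizon M"
    using step.hyps by simp
  have "\<exists>\<phi>. (reward M I \<pi> t y, disb \<pi> t y, \<phi>) \<in> compressed \<U> I t y (act \<pi> t y) (?V (Suc t))
      \<and> \<phi> \<le> ?V t y" if y: "y \<in> attained I t" for y
  proof -
    obtain \<phi> where Q: "(reward M I \<pi> t y, disb \<pi> t y, \<phi>)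
          \<in> Q_at M \<U> I t y (opt_val M \<U> I \<Phi>\<^sub>b (Suc t)) (act \<pi> t y)"
      and min: "\<And>X z \<phi>'. (X, z, \<phi>') \<in> Q_set M \<U> I t y (opt_val M \<U> I \<Phi>\<^sub>b (Suc t)) \<Longrightarrow> \<phi> \<le> \<phi>'"
      using greedyE[OF assms(2,4) t y] by blast
    have "\<phi> \<le> ?V t y"
      using val_in_Q_set[OF assms(2,3) t y] min by blast
    with Q_at_val[OF assms(1-3) t y Q] show ?thesis
      by blast
  qed
  \<comment> \<open>The greedy minima are collected into one function of the state, because
    feasibility constrains all attained states at once.\<close>
  then obtain \<phi> where \<phi>: "\<And>y. y \<in> attained I t \<Longrightarrow>
      (reward M I \<pi> t y, disb \<pi> t y, \<phi> y) \<in> compressed \<U> I t y (act \<pi> t y) (?V (Suc t))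
      \<and> \<phi> y \<le> ?V t y"
    by metis
  have "tail_feasible M \<U> I \<Phi>\<^sub>b t \<pi> (?V(t := \<phi>))"
    using tail_feasible_step[OF t step.IH] \<phi> by simp
  \<comment> \<open>The greedy policy with \<open>\<phi>\<close> at period \<open>t\<close> is
    itself a candidate in the problem defining the value, which gives the reverse
    inequality.\<close>
  then have ge: "?V t y \<le> \<phi> y" if "y \<in> attained I t" for y
    using val_le[OF assms(3) _ t that] by fastforce
  have "(reward M I \<pi> t y, disb \<pi> t y, ?V t y) \<in> compressed \<U> I t y (act \<pi> t y) (?V (Suc t))"
    if "y \<in> attained I t" for y
    using \<phi>[OF that] ge[OF that] by (metis order_antisym)
  \<comment> \<open>The update is trivial; it only brings the goal into the shape of
    \<open>tail_feasible_step\<close>.\<close>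
  then have "tail_feasible M \<U> I \<Phi>\<^sub>b t \<pi> (?V(t := ?V t))"
    by (intro tail_feasible_step[OF t step.IH]) simp
  then show ?case
    by simp
qed

theorem theorem29:
  fixes M :: "('s::finite, 'a::finite, 'x::finite) mdp"
    and Rmax :: real
    and W :: "('a, 'x) act_rule \<Rightarrow> ('a, 'x) triple_set"
    and \<U> :: "('a, 'x) step_sets"
    and \<Phi>\<^sub>e :: "('a, 'x) rhistory \<Rightarrow> real"
    and I :: "('s, 'a, 'x, 'y::banach) info"
    and \<Phi>\<^sub>b :: "'y \<Rightarrow> real"
    and \<pi> :: "('a, 'y) policy"
  assumes "\<And>t s a \<xi>. t \<le> horizon M \<Longrightarrow> \<bar>payoff M t s a \<xi>\<bar> \<le> Rmax"
    and "\<And>\<alpha>. risk_frontier M \<alpha> (W \<alpha>)"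
    and "recursive_structure M \<U> \<Phi>\<^sub>e W"
    and "info_structure M I"
    and "info_state_generator M \<U> \<Phi>\<^sub>e I \<Phi>\<^sub>b"
    and "vals_exist M \<U> I \<Phi>\<^sub>b"
    and "greedy M \<U> I \<Phi>\<^sub>b \<pi>"
  shows "gcr_mdp_optimal M \<U> I \<Phi>\<^sub>b \<pi> \<and>
         (\<forall>t\<le>horizon M. \<forall>y\<in>attained I t. tail_optimal M \<U> I \<Phi>\<^sub>b t y \<pi>)"
proof (intro conjI allI impI ballI)
  let ?V = "val M \<U> I \<Phi>\<^sub>b"
  have feas: "tail_feasible M \<U> I \<Phi>\<^sub>b t \<pi> ?V" if "t \<le> horizon M" for t
    using tail_feasible_greedy_val[OF assms(3,4,6,7)] that by simp
  have "compress I 0 [] \<in> attained I 0"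
    by (simp add: attained_def histories_def)
  \<comment> \<open>Lower bound over all competing pairs of policy and capital process; the pair of
    greedy policy and \<open>?V\<close> attains it.\<close>
  then have "?V 0 (compress I 0 []) \<le> \<Phi> 0 (compress I 0 [])"
    if "tail_feasible M \<U> I \<Phi>\<^sub>b 0 \<pi>' \<Phi>" for \<pi>' \<Phi>
    using val_le[OF assms(6) that] by simp
  then show "gcr_mdp_optimal M \<U> I \<Phi>\<^sub>b \<pi>"
    using feas[of 0] unfolding gcr_mdp_optimal_def markov_frontier_iff_tail_feasible
    by (intro exI[of _ ?V]) (auto simp: is_arg_min_linorder)
  fix t y
  assume t: "t \<le> horizon M" and y: "y \<in> attained I t"
  have val: "opt_val M \<U> I \<Phi>\<^sub>b t y = ereal (?V t y)"
    using opt_val_eq_val[OF assms(6) _ y] t by simp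
  \<comment> \<open>\<open>?V\<close> is an admissible capital process for the greedy policy. With
    the general lower bound this gives both equality of values and attainment, by the same
    \<open>?V\<close> at every state.\<close>
  have "policy_val M \<U> I \<Phi>\<^sub>b t \<pi> y \<le> ereal (?V t y)"
    unfolding policy_val_def using feas[OF t] by (intro Inf_lower) blast
  moreover have "opt_val M \<U> I \<Phi>\<^sub>b t y \<le> policy_val M \<U> I \<Phi>\<^sub>b t \<pi> y"
    using t by (rule opt_val_le_policy_val)
  ultimately show "tail_optimal M \<U> I \<Phi>\<^sub>b t y \<pi>"
    using feas[OF t] val unfolding tail_optimal_def by (metis order_antisym)
qed

end
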